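(* For a linear code $\mathcal{C}_1\subseteq\mathbb{F}_{q^m}^n$ and a subcode $\mathcal{C}_2\subsetneqq\mathcal{C}_1$, the first relative generalized rank weight satisfies $$M_{R,1}(\mathcal{C}_1,\mathcal{C}_2)=\min\{d_R(x,0):x\in\mathcal{C}_1\setminus\mathcal{C}_2\}.$$
   Context: $\mathbb{F}_{q^m}$ is the degree-$m$ extension ($m\ge1$) of the finite field $\mathbb{F}_q$. Linear codes are $\mathbb{F}_{q^m}$-subspaces of $\mathbb{F}_{q^m}^n$; dimensions are over $\mathbb{F}_{q^m}$. For a subspace $V\subseteq\mathbb{F}_{q^m}^n$ put $V^q=\{[v_1^q,\dots,v_n^q]: v\in V\}$, and let $\Gamma(\mathbb{F}_{q^m}^n)$ be the set of $\mathbb{F}_{q^m}$-subspaces $V\subseteq\mathbb{F}_{q^m}^n$ with $V=V^q$. For $0\le i\le\dim(\mathcal{C}_1/\mathcal{C}_2)$, the $i$-th relative generalized rank weight is $M_{R,i}(\mathcal{C}_1,\mathcal{C}_2)=\min\{\dim V: V\in\Gamma(\mathbb{F}_{q^m}^n),\ \dim(\mathcal{C}_1\cap V)-\dim(\mathcal{C}_2\cap V)\ge i\}$. The rank distance $d_R(x,y)$ of $x,y\in\mathbb{F}_{q^m}^n$ is the $\mathbb{F}_q$-dimension of the $\mathbb{F}_q$-span in $\mathbb{F}_{q^m}$ of the coordinates of $y-x$. *)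

theory Defs
  imports "HOL-Analysis.Analysis"
begin

text \<open>
  The extension of finite fields is given by an embedding \<open>\<iota>\<close> of the base field \<open>'k\<close> (with
  \<open>q = CARD('k)\<close>) into \<open>'a\<close>; the base field as a subset of \<open>'a\<close> is \<open>range \<iota>\<close>.
  Injectivity is automatic since the domain is a field.
\<close>

definition field_embedding :: "('k::field \<Rightarrow> 'a::field) \<Rightarrow> bool" where
  "field_embedding \<iota> \<longleftrightarrow>
     \<iota> 1 = 1 \<and> (\<forall>a b. \<iota> (a + b) = \<iota> a + \<iota> b) \<and> (\<forall>a b. \<iota> (a * b) = \<iota> a * \<iota> b)"

definition base_scale :: "('k::field \<Rightarrow> 'a::field) \<Rightarrow> 'k \<Rightarrow> 'a \<Rightarrow> 'a" where
  "base_scale \<iota> c x = \<iota> c * x"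

lemma vector_space_base_scale:
  assumes "field_embedding \<iota>"
  shows "vector_space (base_scale \<iota>)"
  using assms
  by unfold_locales (auto simp: field_embedding_def base_scale_def algebra_simps)

definition extension_of_degree :: "('k::field \<Rightarrow> 'a::field) \<Rightarrow> nat \<Rightarrow> bool" where
  "extension_of_degree \<iota> m \<longleftrightarrow>
     field_embedding \<iota> \<and> vector_space.dim (base_scale \<iota>) (UNIV :: 'a set) = m"

definition frob_image :: "nat \<Rightarrow> ('a::field ^ 'n) set \<Rightarrow> ('a ^ 'n) set" where
  "frob_image q V = (\<lambda>v. \<chi> i. (v $ i) ^ q) ` V"

definition Gamma_spaces :: "nat \<Rightarrow> ('a::field ^ 'n) set set" where
  "Gamma_spaces q = {V. vec.subspace V \<and> V = frob_image q V}"

text \<open>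
  The difference of dimensions is taken in \<open>int\<close> to avoid truncated subtraction. Over a finite
  extension field of a field with \<open>q\<close> elements the set below is finite, and for \<open>C2 \<subseteq> C1\<close> and \<open>i \<le> vec.dim C1 - vec.dim C2\<close> it contains
  the dimension of the whole space, so that \<open>Min\<close> is a genuine minimum. Outside this range of
  \<open>i\<close> the value is meaningless.
\<close>

definition rel_gen_rank_weight ::
    "nat \<Rightarrow> nat \<Rightarrow> ('a::field ^ 'n) set \<Rightarrow> ('a ^ 'n) set \<Rightarrow> nat" where
  "rel_gen_rank_weight q i C1 C2 =
     Min {vec.dim V | V. V \<in> Gamma_spaces q \<and>
            int (vec.dim (C1 \<inter> V)) - int (vec.dim (C2 \<inter> V)) \<ge> int i}"

definition rank_dist :: "('k::field \<Rightarrow> 'a::field) \<Rightarrow> 'a ^ 'n \<Rightarrow> 'a ^ 'n \<Rightarrow> nat" where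
  "rank_dist \<iota> x y =
     vector_space.dim (base_scale \<iota>)
       (module.span (base_scale \<iota>) (range (\<lambda>i. (y - x) $ i)))"

end

theory Submission
  imports Defs "HOL-Computational_Algebra.Polynomial"
begin

text \<open>
  The Frobenius-stable subspaces are exactly those spanned by vectors over the base field: a
  nonzero vector of minimal support in such a subspace, scaled to have a coordinate equal to 1,
  is fixed by Frobenius, since its difference with its image has smaller support; splitting it
  off allows induction. If \<open>V\<close> has a basis \<open>b\<^sub>1, \<dots>, b\<^sub>r\<close> over the base field and
  \<open>x = \<Sum> a\<^sub>j b\<^sub>j\<close>, then the coordinates of \<open>x\<close> lie in the base-field span of the \<open>a\<^sub>j\<close>, so
  \<open>d\<^sub>R(x, 0) \<le> dim V\<close>. Conversely, expanding the coordinates of \<open>x\<close> in a base-field basis of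
  their span yields a stable \<open>V \<ni> x\<close> with \<open>dim V \<le> d\<^sub>R(x, 0)\<close>. Finally,
  \<open>dim (C1 \<inter> V) > dim (C2 \<inter> V)\<close> iff \<open>V\<close> meets \<open>C1 - C2\<close>.
\<close>

section \<open>Frobenius over a finite base field\<close>

text \<open>Multiplication by a nonzero \<open>c\<close> permutes the nonzero elements, so it leaves
  their product unchanged; cancelling that product gives \<open>c ^ (q - 1) = 1\<close>.\<close>

lemma finite_field_power_card:
  fixes c :: "'k::{field,finite}"
  shows "c ^ CARD('k) = c"
proof (cases "c = 0")
  case True
  then show ?thesis by (simp add: power_0_left)
next
  case False
  let ?S = "UNIV - {0 :: 'k}"
  have "bij_betw ((*) c) ?S ?S"
    by (rule bij_betwI[where g = "\<lambda>x. x / c"]) (use False in auto)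
  then have "(\<Prod>x\<in>?S. c * x) = \<Prod>?S"
    by (rule prod.reindex_bij_betw)
  then have "c ^ card ?S * \<Prod>?S = \<Prod>?S"
    by (simp add: prod.distrib)
  then have "c ^ card ?S = 1" by simp
  moreover have "CARD('k) = Suc (card ?S)"
    by (subst card_Suc_Diff1) auto
  ultimately show ?thesis by (simp only: power_Suc mult_1_right)
qed

lemma card_field_ge_2: "CARD('k::{field,finite}) \<ge> 2"
proof -
  have "card {0, 1 :: 'k} \<le> CARD('k)" by (rule card_mono) auto
  then show ?thesis by simp
qed

abbreviation frob :: "nat \<Rightarrow> 'a::power ^ 'n \<Rightarrow> 'a ^ 'n" where
  "frob q v \<equiv> \<chi> i. (v $ i) ^ q"

context
  fixes \<iota> :: "'k::{field,finite} \<Rightarrow> 'a::field"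
  assumes emb: "field_embedding \<iota>"
begin

lemma embedding_add: "\<iota> (a + b) = \<iota> a + \<iota> b"
  and embedding_mult: "\<iota> (a * b) = \<iota> a * \<iota> b"
  and embedding_1: "\<iota> 1 = 1"
  using emb by (auto simp: field_embedding_def)

lemma embedding_power: "\<iota> (c ^ n) = \<iota> c ^ n"
  by (induction n) (simp_all add: embedding_mult embedding_1)

lemma embedding_power_card: "\<iota> c ^ CARD('k) = \<iota> c"
  by (simp add: finite_field_power_card flip: embedding_power)

lemma inj_embedding: "inj \<iota>"
proof (rule injI)
  fix a b assume eq: "\<iota> a = \<iota> b"
  have "\<iota> (a - b) = 0" using embedding_add[of "a - b" b] eq by simp
  moreover have "\<iota> (a - b) * \<iota> (inverse (a - b)) = 1" if "a \<noteq> b"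
    using that by (simp add: embedding_1 flip: embedding_mult)
  ultimately show "a = b" by auto
qed

lemma card_range_embedding: "card (range \<iota>) = CARD('k)"
  by (rule card_image[OF inj_embedding])

text \<open>
  Both sides are monic polynomials in \<open>x\<close> of degree \<open>q\<close> that agree on the \<open>q\<close> elements of the
  base field. This avoids having to know that \<open>q\<close> is a power of the characteristic.
\<close>

lemma power_card_add_1: "(x + 1 :: 'a) ^ CARD('k) = x ^ CARD('k) + 1"
proof -
  let ?q = "CARD('k)"
  have "[:1, 1 :: 'a:] ^ ?q = monom 1 ?q + 1"
  proof (rule poly_eqI_degree_lead_coeff[where n = ?q and A = "range \<iota>"])
    show "coeff ([:1, 1 :: 'a:] ^ ?q) ?q = coeff (monom 1 ?q + 1) ?q"
      by (simp add: coeff_linear_power)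
    show "degree ([:1, 1 :: 'a:] ^ ?q) \<le> ?q"
      by (rule degree_linear_power[THEN eq_refl])
    show "degree (monom (1 :: 'a) ?q + 1) \<le> ?q"
      by (intro degree_add_le) (simp_all add: degree_monom_le)
    fix z assume "z \<in> range \<iota>"
    then obtain c where z: "z = \<iota> c" by blast
    have "(z + 1) ^ ?q = z + 1"
      using embedding_power_card[of "c + 1"] by (simp add: z embedding_add embedding_1)
    moreover have "z ^ ?q = z" by (simp add: z embedding_power_card)
    ultimately show "poly ([:1, 1:] ^ ?q) z = poly (monom 1 ?q + 1) z"
      by (simp add: poly_monom add.commute)
  qed (simp add: card_range_embedding)
  from arg_cong[OF this, of "\<lambda>p. poly p x"] show ?thesis
    by (simp add: poly_monom add.commute)
qed

lemma power_card_add: "(x + y :: 'a) ^ CARD('k) = x ^ CARD('k) + y ^ CARD('k)"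
proof (cases "y = 0")
  case False
  have "x + y = (x / y + 1) * y"
    \<comment> \<open>Dividing by \<open>y\<close> reduces additivity to the case of a summand
      1.\<close>
    using False by (simp add: field_simps)
  then have "(x + y) ^ CARD('k) = (x / y + 1) ^ CARD('k) * y ^ CARD('k)"
    by (simp only: power_mult_distrib)
  also have "\<dots> = x ^ CARD('k) + y ^ CARD('k)"
    using False by (simp add: power_card_add_1 power_divide distrib_right)
  finally show ?thesis .
qed (simp add: power_0_left)

lemma power_card_diff: "(x - y :: 'a) ^ CARD('k) = x ^ CARD('k) - y ^ CARD('k)"
  using power_card_add[of "x - y" y] by simp

text \<open>The polynomial \<open>X^q - X\<close> has at most \<open>q\<close> roots, and the base
  field already supplies \<open>q\<close> of them.\<close>

lemma power_card_fixed_in_range: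
  fixes x :: 'a
  assumes "x ^ CARD('k) = x"
  shows "x \<in> range \<iota>"
proof -
  let ?p = "monom 1 CARD('k) - [:0, 1 :: 'a:]"
  have ge: "CARD('k) \<ge> 2" by (rule card_field_ge_2)
  \<comment> \<open>Since \<open>q \<ge> 2\<close>, the linear term cannot cancel the leading
    one.\<close>
  have "coeff ?p CARD('k) = 1"
    using ge by (cases "CARD('k)") (auto simp: coeff_pCons split: nat.splits)
  then have "?p \<noteq> 0" by (metis coeff_0 zero_neq_one)
  moreover have "degree ?p \<le> CARD('k)"
    using ge by (intro degree_diff_le) (simp_all add: degree_monom_le)
  ultimately have "card {z. poly ?p z = 0} \<le> card (range \<iota>)" and "finite {z. poly ?p z = 0}"
    using card_poly_roots_bound[of ?p] poly_roots_finite[of ?p] card_range_embedding by linarith+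
  moreover have "range \<iota> \<subseteq> {z. poly ?p z = 0}"
    by (auto simp: poly_monom embedding_power_card)
  ultimately have "range \<iota> = {z. poly ?p z = 0}"
    by (metis card_seteq)
  with assms show ?thesis by (auto simp: poly_monom)
qed

section \<open>Frobenius-stable subspaces\<close>

lemma frob_stable_spanned_by_rational:
  fixes V :: "('a ^ 'n) set"
  assumes "vec.subspace V" and "\<And>v. v \<in> V \<Longrightarrow> frob CARD('k) v \<in> V"
  shows "V \<subseteq> vec.span {v \<in> V. \<forall>i. v $ i \<in> range \<iota>}"
  using assms
proof (induction "vec.dim V" arbitrary: V rule: less_induct)
  case less
  note sub = \<open>vec.subspace V\<close>
  define supp where "supp v = {i. v $ i \<noteq> 0}" for v :: "'a ^ 'n"
  show ?case
  proof (cases "V \<subseteq> {0}")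
    case True
    then show ?thesis using vec.span_zero by blast
  next
    case False
    then obtain w0 where "w0 \<in> V \<and> w0 \<noteq> 0" by auto
    from ex_has_least_nat[of "\<lambda>v. v \<in> V \<and> v \<noteq> 0", OF this, of "\<lambda>v. card (supp v)"]
    obtain w where w: "w \<in> V" "w \<noteq> 0"
      and least: "\<And>v. v \<in> V \<Longrightarrow> v \<noteq> 0 \<Longrightarrow> card (supp w) \<le> card (supp v)"
      by blast
    from w obtain i where i: "w $ i \<noteq> 0" by (auto simp: vec_eq_iff)
    define e where "e = inverse (w $ i) *s w"
    have e: "e \<in> V" and ei: "e $ i = 1" and supp_e: "supp e = supp w"
      using w i sub by (auto simp: e_def supp_def vec.subspace_scale)
    \<comment> \<open>Frobenius fixes both 0 and 1: zero coordinates of \<open>e\<close> stay zero,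
      and coordinate \<open>i\<close>, equal to 1, cancels.\<close>
    have "supp (frob CARD('k) e - e) \<subseteq> supp e - {i}"
      by (auto simp: supp_def ei power_0_left)
    then have "supp (frob CARD('k) e - e) \<subset> supp e"
      using ei by (auto simp: supp_def)
    then have "card (supp (frob CARD('k) e - e)) < card (supp w)"
      unfolding supp_e[symmetric] by (rule psubset_card_mono[rotated]) simp
    moreover have "frob CARD('k) e - e \<in> V"
      using e less.prems by (intro vec.subspace_diff) auto
    ultimately have "frob CARD('k) e - e = 0" using least leD by blast
    then have "e $ j ^ CARD('k) = e $ j" for j
      by (simp add: vec_eq_iff)
    then have rat: "\<forall>j. e $ j \<in> range \<iota>" by (blast intro: power_card_fixed_in_range)
    \<comment> \<open>As \<open>e $ i = 1\<close>, \<open>V'\<close> is a complement in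
      \<open>V\<close> of the line through \<open>e\<close>; the condition on coordinate
      \<open>i\<close> survives Frobenius, so the induction hypothesis applies to
      \<open>V'\<close>.\<close>
    define V' where "V' = {v \<in> V. v $ i = 0}"
    have sub': "vec.subspace V'"
      using sub by (auto simp: V'_def vec.subspace_def)
    have "e \<notin> V'" using ei by (simp add: V'_def)
    with e have "V' \<subset> V" by (auto simp: V'_def)
    then have "vec.dim V' < vec.dim V"
      using sub sub' by (metis vec.dim_psubset vec.span_eq_iff)
    moreover have "frob CARD('k) v \<in> V'" if "v \<in> V'" for v
      using that less.prems by (auto simp: V'_def power_0_left)
    ultimately have "V' \<subseteq> vec.span {v \<in> V'. \<forall>i. v $ i \<in> range \<iota>}"
      using less.hyps sub' by blast
    also have "\<dots> \<subseteq> vec.span {v \<in> V. \<forall>i. v $ i \<in> range \<iota>}"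
      by (rule vec.span_mono) (auto simp: V'_def)
    finally have V': "V' \<subseteq> vec.span {v \<in> V. \<forall>i. v $ i \<in> range \<iota>}" .
    show ?thesis
    proof
      fix v assume v: "v \<in> V"
      have "v - v $ i *s e \<in> V'"
        using v e ei sub by (auto simp: V'_def vec.subspace_diff vec.subspace_scale)
      moreover have "v $ i *s e \<in> vec.span {v \<in> V. \<forall>i. v $ i \<in> range \<iota>}"
        using e rat by (intro vec.span_scale vec.span_base) auto
      ultimately have "(v - v $ i *s e) + v $ i *s e \<in> vec.span {v \<in> V. \<forall>i. v $ i \<in> range \<iota>}"
        using V' by (intro vec.span_add) auto
      then show "v \<in> vec.span {v \<in> V. \<forall>i. v $ i \<in> range \<iota>}" by simp
    qed
  qed
qed

text \<open>Frobenius is additive, raises scalars to the power \<open>q\<close>, and fixes every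
  vector of \<open>B\<close>, so it maps linear combinations of \<open>B\<close> to linear
  combinations of \<open>B\<close>.\<close>

lemma span_rational_frob_stable:
  fixes B :: "('a ^ 'n) set"
  assumes rat: "\<And>b i. b \<in> B \<Longrightarrow> b $ i \<in> range \<iota>" and "v \<in> vec.span B"
  shows "frob CARD('k) v \<in> vec.span B"
  using \<open>v \<in> vec.span B\<close>
proof (induction rule: vec.span_induct_alt)
  case base
  have "frob CARD('k) 0 = (0 :: 'a ^ 'n)" by (simp add: vec_eq_iff power_0_left)
  then show ?case by (simp only: vec.span_zero)
next
  case (step c b v)
  have "b $ i ^ CARD('k) = b $ i" for i
    using rat[OF step(1), of i] embedding_power_card by auto
  then have "frob CARD('k) (c *s b + v) = c ^ CARD('k) *s b + frob CARD('k) v"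
    by (simp add: vec_eq_iff power_card_add power_mult_distrib)
  with step show ?case by (simp add: vec.span_add vec.span_scale vec.span_base)
qed

text \<open>Frobenius is additive, and a field has no nonzero element with vanishing
  \<open>q\<close>-th power.\<close>

lemma inj_frob: "inj (frob CARD('k) :: 'a ^ 'n \<Rightarrow> 'a ^ 'n)"
proof (rule injI)
  fix v w :: "'a ^ 'n"
  assume "frob CARD('k) v = frob CARD('k) w"
  then have "(v $ i - w $ i) ^ CARD('k) = 0" for i
    by (simp add: vec_eq_iff power_card_diff)
  then show "v = w" by (simp add: vec_eq_iff)
qed

section \<open>Rank distance and stable subspaces\<close>

interpretation base: vector_space "base_scale \<iota>"
  by (rule vector_space_base_scale[OF emb])

lemma rank_dist_0_eq: "rank_dist \<iota> x 0 = base.dim (range (($) x))"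
proof -
  \<comment> \<open>\<open>rank_dist\<close> uses the coordinates of \<open>0 - x\<close>; the sign
    does not affect their span.\<close>
  have "base.span (range (\<lambda>i. - x $ i)) = base.span (range (($) x))"
    unfolding base.span_eq
    using base.span_neg[OF base.span_base, of _ "range (($) x)"]
      base.span_neg[OF base.span_base, of _ "range (\<lambda>i. - x $ i)"] by fastforce
  then show ?thesis by (simp add: rank_dist_def)
qed

lemma rank_dist_le_dim_Gamma:
  fixes V :: "('a ^ 'n) set"
  assumes "V \<in> Gamma_spaces CARD('k)" and "x \<in> V"
  shows "rank_dist \<iota> x 0 \<le> vec.dim V"
proof -
  let ?R = "{v \<in> V. \<forall>i. v $ i \<in> range \<iota>}"
  have "vec.subspace V"
    using assms(1) by (simp add: Gamma_spaces_def)
  moreover have "frob CARD('k) v \<in> V" if "v \<in> V" for v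
    using assms(1) that by (auto simp: Gamma_spaces_def frob_image_def)
  ultimately have "V \<subseteq> vec.span ?R"
    by (rule frob_stable_spanned_by_rational)
  \<comment> \<open>The basis of \<open>V\<close> is picked among its vectors with base-field
    coordinates, so that coordinates of combinations of \<open>B\<close> are base-field combinations
    of the coefficients.\<close>
  moreover obtain B where B: "B \<subseteq> ?R" "vec.independent B" "?R \<subseteq> vec.span B"
    by (rule vec.basis_exists)
  moreover from B(3) have "vec.span ?R \<subseteq> vec.span B"
    by (rule vec.span_minimal) (rule vec.subspace_span)
  ultimately have VB: "V \<subseteq> vec.span B" by simp
  then have card: "card B = vec.dim V"
    using B by (intro vec.basis_card_eq_dim) auto
  have fin: "finite B" using B by (simp add: vec.finiteI_independent)
  from VB assms(2) obtain a where x: "x = (\<Sum>b\<in>B. a b *s b)"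
    by (auto simp: vec.span_finite[OF fin])
  have "x $ i \<in> base.span (a ` B)" for i
  proof -
    have "a b * b $ i \<in> base.span (a ` B)" if b: "b \<in> B" for b
    proof -
      from B(1) b obtain c where "b $ i = \<iota> c" by auto
      then have "a b * b $ i = base_scale \<iota> c (a b)" by (simp add: base_scale_def)
      with b show ?thesis by (simp add: base.span_scale base.span_base)
    qed
    then show ?thesis by (simp add: x base.span_sum)
  qed
  then have "base.dim (range (($) x)) \<le> card (a ` B)"
    by (intro base.dim_le_card) (auto simp: fin)
  also have "\<dots> \<le> card B" by (rule card_image_le[OF fin])
  finally show ?thesis by (simp add: card rank_dist_0_eq)
qed

end

lemma ex_Gamma_dim_le_rank_dist:
  fixes \<iota> :: "'k::{field,finite} \<Rightarrow> 'a::{field,finite}" and x :: "'a ^ 'n"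
  assumes emb: "field_embedding \<iota>"
  obtains V where "V \<in> Gamma_spaces CARD('k)" "x \<in> V" "vec.dim V \<le> rank_dist \<iota> x 0"
proof -
  interpret base: vector_space "base_scale \<iota>"
    by (rule vector_space_base_scale[OF emb])
  obtain B where B: "range (($) x) \<subseteq> base.span B" "card B = base.dim (range (($) x))"
    by (rule base.basis_exists)
  have "\<exists>u. x $ i = (\<Sum>b\<in>B. \<iota> (u b) * b)" for i
    using B(1) by (auto simp: base.span_finite base_scale_def)
  then obtain u where u: "\<And>i. x $ i = (\<Sum>b\<in>B. \<iota> (u i b) * b)" by metis
  \<comment> \<open>\<open>c b\<close> collects the base-field coefficients of \<open>b\<close>
    across all coordinates of \<open>x\<close>, so \<open>x\<close> is the sum of the
    \<open>b *s c b\<close>.\<close>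
  define c :: "'a \<Rightarrow> 'a ^ 'n" where "c b = (\<chi> i. \<iota> (u i b))" for b
  define V where "V = vec.span (c ` B)"
  have "frob_image CARD('k) V \<subseteq> V"
    unfolding frob_image_def V_def
    by (intro image_subsetI span_rational_frob_stable[OF emb]) (auto simp: c_def)
  \<comment> \<open>Stability needs equality, not just inclusion: as \<open>V\<close> is finite and
    Frobenius injective, counting provides it.\<close>
  moreover have "card (frob_image CARD('k) V) = card V"
    unfolding frob_image_def
    by (rule card_image) (rule inj_on_subset[OF inj_frob[OF emb]], simp)
  ultimately have "frob_image CARD('k) V = V"
    by (intro card_subset_eq) auto
  then have "V \<in> Gamma_spaces CARD('k)"
    by (simp add: Gamma_spaces_def V_def)
  moreover have "x = (\<Sum>b\<in>B. b *s c b)"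
    by (simp add: vec_eq_iff u c_def mult.commute)
  then have "x \<in> V"
    by (simp add: V_def vec.span_sum vec.span_scale vec.span_base)
  moreover have "vec.dim V \<le> card B"
    using vec.dim_le_card'[of "c ` B"] card_image_le[of B c] by (simp add: V_def)
  ultimately show thesis
    using that B(2) by (simp add: rank_dist_0_eq[OF emb])
qed

section \<open>Comparison of the two minima\<close>

text \<open>Mutual domination makes each minimum a lower bound for the other set. It is applied to
  dimensions of stable spaces and rank distances, for which only inequalities have been
  shown.\<close>

lemma Min_eqI_cofinal:
  fixes A B :: "'a::linorder set"
  assumes "finite A" "finite B" "B \<noteq> {}"
    and AB: "\<And>a. a \<in> A \<Longrightarrow> \<exists>b\<in>B. b \<le> a" and BA: "\<And>b. b \<in> B \<Longrightarrow> \<exists>a\<in>A. a \<le> b"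
  shows "Min A = Min B"
proof -
  have "A \<noteq> {}" using BA \<open>B \<noteq> {}\<close> by blast
  show ?thesis
  proof (rule antisym)
    obtain a where "a \<in> A" "a \<le> Min B" using BA[OF Min_in[OF \<open>finite B\<close> \<open>B \<noteq> {}\<close>]] ..
    then show "Min A \<le> Min B" using \<open>finite A\<close> by (meson Min_le order_trans)
    obtain b where "b \<in> B" "b \<le> Min A" using AB[OF Min_in[OF \<open>finite A\<close> \<open>A \<noteq> {}\<close>]] ..
    then show "Min B \<le> Min A" using \<open>finite B\<close> by (meson Min_le order_trans)
  qed
qed

text \<open>A proper inclusion of subspaces is strict in dimension, and \<open>C2 \<inter> V\<close>
  is proper in \<open>C1 \<inter> V\<close> exactly when \<open>V\<close> contains a point of
  \<open>C1 - C2\<close>.\<close>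

lemma dim_Int_less_iff:
  fixes C1 C2 V :: "('a::field ^ 'n) set"
  assumes "vec.subspace C1" "vec.subspace C2" "C2 \<subseteq> C1" "vec.subspace V"
  shows "vec.dim (C2 \<inter> V) < vec.dim (C1 \<inter> V) \<longleftrightarrow> (\<exists>x \<in> C1 - C2. x \<in> V)"
proof
  assume "vec.dim (C2 \<inter> V) < vec.dim (C1 \<inter> V)"
  then have "C2 \<inter> V \<noteq> C1 \<inter> V" by auto
  with assms(3) show "\<exists>x \<in> C1 - C2. x \<in> V" by auto
next
  assume "\<exists>x \<in> C1 - C2. x \<in> V"
  then have "C2 \<inter> V \<subset> C1 \<inter> V" using assms(3) by auto
  then show "vec.dim (C2 \<inter> V) < vec.dim (C1 \<inter> V)"
    using assms by (metis vec.dim_psubset vec.span_eq_iff vec.subspace_inter)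
qed

theorem lemma12:
  fixes \<iota> :: "'k::{field,finite} \<Rightarrow> 'a::{field,finite}"
    and C1 C2 :: "('a ^ 'n) set"
    and q m :: nat
  assumes "q = CARD('k)"
    and "m \<ge> 1"
    and "extension_of_degree \<iota> m"
    and "vec.subspace C1"
    and "vec.subspace C2"
    and "C2 \<subset> C1"
  shows "rel_gen_rank_weight q 1 C1 C2 = Min {rank_dist \<iota> x 0 | x. x \<in> C1 - C2}"
proof -
  have emb: "field_embedding \<iota>"
    using assms(3) by (simp add: extension_of_degree_def)
  let ?A = "{vec.dim V | V. V \<in> Gamma_spaces q \<and> (\<exists>x \<in> C1 - C2. x \<in> V)}"
  let ?B = "{rank_dist \<iota> x 0 | x. x \<in> C1 - C2}"
  \<comment> \<open>For integers, a difference of at least 1 is a strict inequality, so the weight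
    becomes a minimum over the stable spaces meeting \<open>C1 - C2\<close>.\<close>
  have "int (vec.dim (C1 \<inter> V)) - int (vec.dim (C2 \<inter> V)) \<ge> int 1 \<longleftrightarrow> (\<exists>x \<in> C1 - C2. x \<in> V)"
    if "V \<in> Gamma_spaces q" for V
    using dim_Int_less_iff[of C1 C2 V] assms that by (auto simp: Gamma_spaces_def)
  then have "rel_gen_rank_weight q 1 C1 C2 = Min ?A"
    unfolding rel_gen_rank_weight_def by (intro arg_cong[where f = Min]) blast
  also have "\<dots> = Min ?B"
  proof (rule Min_eqI_cofinal)
    show "?B \<noteq> {}" using assms(6) by blast
    show "\<exists>b\<in>?B. b \<le> a" if "a \<in> ?A" for a
      using that rank_dist_le_dim_Gamma[OF emb] assms(1) by blast
    show "\<exists>a\<in>?A. a \<le> b" if "b \<in> ?B" for b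
    proof -
      from that obtain x where x: "x \<in> C1 - C2" "b = rank_dist \<iota> x 0" by blast
      obtain V where "V \<in> Gamma_spaces CARD('k)" "x \<in> V" "vec.dim V \<le> rank_dist \<iota> x 0"
        by (rule ex_Gamma_dim_le_rank_dist[OF emb])
      with x assms(1) show ?thesis by blast
    qed
  qed simp_all
  finally show ?thesis .
qed

end
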